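(* Let $G(V, E)$ be a simple connected graph with diameter $D$, $|V| = n$, and $\mathrm{edim}(G) = k$. Then: $$|E| \leq \binom{k}{2} + kD^{k-1} + D^k .$$
   Context: For an edge $e=xy$ and a vertex $v$, $d(e,v)=\min\{d(x,v),d(y,v)\}$. A set $S\subseteq V$ is an edge metric generator if for any two distinct edges $e_1,e_2$ some $s\in S$ has $d(e_1,s)\neq d(e_2,s)$; $\mathrm{edim}(G)$ is the minimum size of an edge metric generator. The diameter is $\max\{d(u,v)\mid u,v\in V\}$. *)

theory Defs
  imports Main
begin

text \<open>A graph is given by its vertex set and its set of edges, an edge being the two-element set
  of its end vertices.\<close>

definition simple_graph :: "'a set \<Rightarrow> 'a set set \<Rightarrow> bool" where
  "simple_graph V E \<longleftrightarrow> finite V \<and> V \<noteq> {} \<and> (\<forall>e\<in>E. e \<subseteq> V \<and> card e = 2)"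

text \<open>A walk is the nonempty list of the vertices it visits; its length (number of edges)
  is one less than the length of the list.\<close>

definition walk_betw :: "'a set \<Rightarrow> 'a set set \<Rightarrow> 'a \<Rightarrow> 'a list \<Rightarrow> 'a \<Rightarrow> bool" where
  "walk_betw V E u p v \<longleftrightarrow> p \<noteq> [] \<and> set p \<subseteq> V \<and> hd p = u \<and> last p = v
     \<and> successively (\<lambda>x y. {x, y} \<in> E) p"

definition connected_graph :: "'a set \<Rightarrow> 'a set set \<Rightarrow> bool" where
  "connected_graph V E \<longleftrightarrow> (\<forall>u\<in>V. \<forall>v\<in>V. \<exists>p. walk_betw V E u p v)"

text \<open>Meaningful only if some walk joins the two vertices; the value is unspecified otherwise.\<close>

definition graph_dist :: "'a set \<Rightarrow> 'a set set \<Rightarrow> 'a \<Rightarrow> 'a \<Rightarrow> nat" where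
  "graph_dist V E u v = (LEAST l. \<exists>p. walk_betw V E u p v \<and> length p = Suc l)"

definition graph_diameter :: "'a set \<Rightarrow> 'a set set \<Rightarrow> nat" where
  "graph_diameter V E = Max {graph_dist V E u v | u v. u \<in> V \<and> v \<in> V}"

definition edge_dist :: "'a set \<Rightarrow> 'a set set \<Rightarrow> 'a set \<Rightarrow> 'a \<Rightarrow> nat" where
  "edge_dist V E e v = Min {graph_dist V E x v | x. x \<in> e}"

definition edge_metric_generator :: "'a set \<Rightarrow> 'a set set \<Rightarrow> 'a set \<Rightarrow> bool" where
  "edge_metric_generator V E S \<longleftrightarrow> S \<subseteq> V \<and>
     (\<forall>e\<^sub>1\<in>E. \<forall>e\<^sub>2\<in>E. e\<^sub>1 \<noteq> e\<^sub>2 \<longrightarrow> (\<exists>s\<in>S. edge_dist V E e\<^sub>1 s \<noteq> edge_dist V E e\<^sub>2 s))"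

text \<open>The empty set is admitted as a generator, so a graph with at most one edge has edge metric
  dimension 0.\<close>

definition edim :: "'a set \<Rightarrow> 'a set set \<Rightarrow> nat" where
  "edim V E = Min {card S | S. edge_metric_generator V E S}"

end

theory Submission
  imports Defs "HOL-Library.FuncSet"
begin

text \<open>Fix a minimum edge metric generator \<open>S\<close>. The distance vector of an edge \<open>e\<close> to the elements
  of \<open>S\<close> determines \<open>e\<close>, has entries in \<open>{0..D}\<close>, and vanishes exactly at the coordinates in
  \<open>e \<inter> S\<close>. Hence at most \<open>D ^ (k - card T)\<close> edges meet \<open>S\<close> in a given set \<open>T\<close>. Apply this with \<open>T\<close>
  empty and with \<open>T\<close> each of the \<open>k\<close> singletons; every other edge is a two-element subset
  of \<open>S\<close>.\<close>

lemma graph_dist_self: "u \<in> V \<Longrightarrow> graph_dist V E u u = 0"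
  unfolding graph_dist_def
  by (rule Least_eq_0) (auto intro!: exI[of _ "[u]"] simp: walk_betw_def)

lemma shortest_walk:
  assumes "connected_graph V E" "u \<in> V" "v \<in> V"
  obtains p where "walk_betw V E u p v" "length p = Suc (graph_dist V E u v)"
proof -
  obtain q where "walk_betw V E u q v"
    using assms unfolding connected_graph_def by blast
  \<comment> \<open>A walk is a nonempty list, so its length has the form \<open>Suc l\<close> and
    the \<open>LEAST\<close> in the distance ranges over a nonempty set of numbers.\<close>
  moreover from this have "length q = Suc (length q - 1)"
    by (simp add: walk_betw_def)
  ultimately have "\<exists>l p. walk_betw V E u p v \<and> length p = Suc l" by blast
  from LeastI_ex[OF this] show ?thesis
    using that unfolding graph_dist_def by blast
qed

lemma graph_dist_eq_0_iff:
  assumes "connected_graph V E" "u \<in> V" "v \<in> V"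
  shows "graph_dist V E u v = 0 \<longleftrightarrow> u = v"
proof
  assume "graph_dist V E u v = 0"
  then obtain p where "walk_betw V E u p v" "length p = Suc 0"
    using shortest_walk[OF assms] by metis
  then show "u = v" by (auto simp: walk_betw_def length_Suc_conv)
qed (use assms graph_dist_self in auto)

lemma graph_dist_le_diameter:
  assumes "finite V" "u \<in> V" "v \<in> V"
  shows "graph_dist V E u v \<le> graph_diameter V E"
proof -
  have "{graph_dist V E u v | u v. u \<in> V \<and> v \<in> V} = (\<lambda>(u, v). graph_dist V E u v) ` (V \<times> V)"
    by auto
  with assms(1) have "finite {graph_dist V E u v | u v. u \<in> V \<and> v \<in> V}" by simp
  then show ?thesis
    unfolding graph_diameter_def using assms(2,3) by (intro Max_ge) auto
qed

text \<open>An edge is finite and nonempty, so its \<open>Min\<close> is a value at one of its ends.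
  This carries the bound by the diameter, and one half of the zero criterion, from vertices to
  edges.\<close>

lemma edge_dist_attained:
  assumes "simple_graph V E" "e \<in> E"
  obtains x where "x \<in> e" "x \<in> V" "edge_dist V E e v = graph_dist V E x v"
proof -
  have e: "e \<subseteq> V" "card e = 2" using assms by (auto simp: simple_graph_def)
  then have "finite e" "e \<noteq> {}" by (auto intro: card_ge_0_finite)
  then have "Min ((\<lambda>x. graph_dist V E x v) ` e) \<in> (\<lambda>x. graph_dist V E x v) ` e"
    by (intro Min_in) auto
  then show ?thesis
    using that e(1) by (auto simp: edge_dist_def Setcompr_eq_image)
qed

lemma edge_dist_le_diameter:
  assumes "simple_graph V E" "e \<in> E" "v \<in> V"
  shows "edge_dist V E e v \<le> graph_diameter V E"
  using edge_dist_attained[OF assms(1,2), of v] graph_dist_le_diameter assms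
  by (metis simple_graph_def)

lemma edge_dist_eq_0_iff:
  assumes "simple_graph V E" "connected_graph V E" "e \<in> E" "v \<in> V"
  shows "edge_dist V E e v = 0 \<longleftrightarrow> v \<in> e"
proof
  assume "edge_dist V E e v = 0"
  then show "v \<in> e"
    using edge_dist_attained[OF assms(1,3), of v] graph_dist_eq_0_iff[OF assms(2)] assms(4)
    by metis
next
  assume v: "v \<in> e"
  have "finite e"
    using assms(1,3) by (auto simp: simple_graph_def intro: finite_subset)
  then have "edge_dist V E e v \<le> graph_dist V E v v"
    unfolding edge_dist_def using v by (intro Min_le) auto
  then show "edge_dist V E e v = 0"
    using graph_dist_self[OF assms(4)] by simp
qed

text \<open>An end of one edge that is not on the other has distance 0 to the first only. This makes
  the set under \<open>Min\<close> in \<open>edim\<close> nonempty.\<close>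

lemma edge_metric_generator_vertices:
  assumes "simple_graph V E" "connected_graph V E"
  shows "edge_metric_generator V E V"
  unfolding edge_metric_generator_def
proof (intro conjI ballI impI)
  fix e f assume ef: "e \<in> E" "f \<in> E" "e \<noteq> f"
  have "e \<subseteq> V" "card e = 2" "finite f" "card f = 2"
    using assms(1) ef(1,2) by (auto simp: simple_graph_def intro: finite_subset)
  \<comment> \<open>Distinct sets of the same finite size are not nested.\<close>
  with ef(3) obtain x where "x \<in> e" "x \<notin> f" "x \<in> V"
    by (metis card_subset_eq subset_iff)
  then show "\<exists>s\<in>V. edge_dist V E e s \<noteq> edge_dist V E f s"
    using edge_dist_eq_0_iff[OF assms] ef(1,2) by metis
qed simp

lemma edim_attained:
  assumes "simple_graph V E" "connected_graph V E"
  obtains S where "edge_metric_generator V E S" "card S = edim V E"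
proof -
  have "finite V" using assms(1) by (simp add: simple_graph_def)
  then have "finite (card ` Pow V)" by simp
  moreover have "{card S | S. edge_metric_generator V E S} \<subseteq> card ` Pow V"
    unfolding edge_metric_generator_def by blast
  ultimately have "finite {card S | S. edge_metric_generator V E S}"
    by (rule rev_finite_subset)
  moreover have "{card S | S. edge_metric_generator V E S} \<noteq> {}"
    using edge_metric_generator_vertices[OF assms] by blast
  ultimately have "edim V E \<in> {card S | S. edge_metric_generator V E S}"
    unfolding edim_def by (rule Min_in)
  then show ?thesis using that by auto
qed

text \<open>The coordinates in \<open>T\<close> are forced to be 0 and the remaining ones avoid 0,
  which leaves \<open>D\<close> rather than \<open>D + 1\<close> values for each coordinate in
  \<open>S - T\<close>.\<close>

lemma card_edges_trace_le:
  assumes G: "simple_graph V E" "connected_graph V E"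
    and S: "edge_metric_generator V E S" and "T \<subseteq> S"
  shows "card {e \<in> E. e \<inter> S = T} \<le> graph_diameter V E ^ (card S - card T)"
proof -
  let ?F = "{e \<in> E. e \<inter> S = T}" and ?D = "graph_diameter V E"
  \<comment> \<open>Restricting makes the vector extensional, so that it lies in a
    \<open>PiE\<close> set of known cardinality.\<close>
  let ?r = "\<lambda>e. restrict (edge_dist V E e) (S - T)"
  have SV: "S \<subseteq> V" using S by (simp add: edge_metric_generator_def)
  then have fin: "finite S" "finite T"
    using G(1) \<open>T \<subseteq> S\<close> by (meson simple_graph_def finite_subset)+
  have zero: "edge_dist V E e s = 0 \<longleftrightarrow> s \<in> T" if "e \<in> ?F" "s \<in> S" for e s
    using edge_dist_eq_0_iff[OF G, of e s] that SV by blast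
  have "inj_on ?r ?F"
  proof (rule inj_onI, rule ccontr)
    fix e f assume ef: "e \<in> ?F" "f \<in> ?F" "?r e = ?r f" "e \<noteq> f"
    then obtain s where s: "s \<in> S" "edge_dist V E e s \<noteq> edge_dist V E f s"
      using S unfolding edge_metric_generator_def by blast
    \<comment> \<open>On \<open>T\<close> both distances are 0, so a separating \<open>s\<close>
      survives the restriction.\<close>
    then have "s \<in> S - T" using zero[OF ef(1)] zero[OF ef(2)] by (metis DiffI)
    with fun_cong[OF ef(3), of s] s(2) show False by simp
  qed
  moreover have "?r ` ?F \<subseteq> (S - T) \<rightarrow>\<^sub>E {1..?D}"
  proof (rule image_subsetI, rule restrict_PiE_iff[THEN iffD2], rule ballI)
    fix e s assume es: "e \<in> ?F" "s \<in> S - T"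
    then show "edge_dist V E e s \<in> {1..?D}"
      using zero[of e s] edge_dist_le_diameter[OF G(1), of e s] SV by auto
  qed
  ultimately have "card ?F \<le> card ((S - T) \<rightarrow>\<^sub>E {1..?D})"
    using fin by (intro card_inj_on_le) (auto intro: finite_PiE)
  also have "\<dots> = ?D ^ (card S - card T)"
    using fin \<open>T \<subseteq> S\<close> by (simp add: card_PiE card_Diff_subset)
  finally show ?thesis .
qed

theorem theorem3p4:
  fixes V :: "'a set" and E :: "'a set set" and n k D :: nat
  assumes "simple_graph V E"
    and "connected_graph V E"
    and "graph_diameter V E = D"
    and "card V = n"
    and "edim V E = k"
  shows "card E \<le> (k choose 2) + k * D ^ (k - 1) + D ^ k"
proof -
  obtain S where S: "edge_metric_generator V E S" "card S = k"
    using edim_attained[OF assms(1,2)] assms(5) by metis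
  have "finite S"
    using S(1) assms(1)
    by (auto simp: edge_metric_generator_def simple_graph_def intro: finite_subset)
  have finE: "finite E"
    using assms(1) by (intro finite_subset[of E "Pow V"]) (auto simp: simple_graph_def)
  let ?P = "{e. e \<subseteq> S \<and> card e = 2}"
  let ?X = "\<lambda>T. {e \<in> E. e \<inter> S = T}"
  have X: "card (?X T) \<le> D ^ (k - card T)" if "T \<subseteq> S" for T
    using card_edges_trace_le[OF assms(1,2) S(1) that] S(2) assms(3) by simp
  \<comment> \<open>The three parts collect the edges with two, one and no ends in
    \<open>S\<close>.\<close>
  have "E \<subseteq> ?P \<union> (\<Union>s\<in>S. ?X {s}) \<union> ?X {}"
  proof
    fix e assume e: "e \<in> E"
    then have "card e = 2" using assms(1) by (simp add: simple_graph_def)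
    then obtain x y where "e = {x, y}" "x \<noteq> y" by (auto simp: card_2_iff)
    with e \<open>card e = 2\<close> show "e \<in> ?P \<union> (\<Union>s\<in>S. ?X {s}) \<union> ?X {}"
      by (cases "x \<in> S"; cases "y \<in> S") auto
  qed
  moreover have "finite ?P" using \<open>finite S\<close> by simp
  ultimately have "card E \<le> card (?P \<union> (\<Union>s\<in>S. ?X {s}) \<union> ?X {})"
    using finE \<open>finite S\<close> by (intro card_mono) auto
  also have "\<dots> \<le> card ?P + card (\<Union>s\<in>S. ?X {s}) + card (?X {})"
    by (meson card_Un_le add_le_mono order.trans order.refl)
  also have "\<dots> \<le> (k choose 2) + k * D ^ (k - 1) + D ^ k"
  proof (intro add_le_mono)
    show "card ?P \<le> k choose 2" using n_subsets[OF \<open>finite S\<close>] S(2) by simp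
    have "card (\<Union>s\<in>S. ?X {s}) \<le> (\<Sum>s\<in>S. card (?X {s}))"
      by (rule card_UN_le[OF \<open>finite S\<close>])
    \<comment> \<open>The exponent comes from \<open>card {s} = 1\<close>. For \<open>k = 0\<close>
      the truncated \<open>k - 1\<close> is harmless, since the sum is then empty.\<close>
    also have "\<dots> \<le> (\<Sum>s\<in>S. D ^ (k - 1))"
      using X[of "{_}"] by (intro sum_mono) auto
    finally show "card (\<Union>s\<in>S. ?X {s}) \<le> k * D ^ (k - 1)" using S(2) by simp
    show "card (?X {}) \<le> D ^ k" using X[of "{}"] by simp
  qed
  finally show ?thesis .
qed

end
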